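(* Let $m\ge2$ and let $\mathcal K\ne\Delta_{[m]}$ be a simplicial complex on $[m]$, with Alexander dual $\mathcal K^\vee$. Then $$M_{\mathcal K}(t)=E_{\mathcal K^\vee}(t).$$ In particular, $\mu_i(\mathcal K)=\alpha_i(\mathcal K^\vee)$ for $i=0,1,\dots,m-1$.
   Context: For $m\ge 2$ let $[m]=\{1,\dots,m\}$. A simplicial complex on $[m]$ is a family of subsets of $[m]$ containing $\varnothing$ and closed under taking subsets (some singletons may be missing); $\Delta_{[m]}=2^{[m]}$. $f_i=f_i(\mathcal K)$ is the number of faces with $i+1$ elements ($f_{-1}=1$). Alexander dual: $\mathcal K^\vee=\{[m]\setminus\tau : \tau\subseteq[m],\ \tau\notin\mathcal K\}$ (regarded as a complex on $m$ vertices). $\alpha$-vector: $\alpha_k(\mathcal K)=\sum_{S\in\mathcal K,\,|S|=k}\bigl(1-\chi(\mathrm{link}_{\mathcal K}S)\bigr)$, $0\le k\le m-1$, where $\mathrm{link}_{\mathcal K}S=\{T\in\mathcal K: T\cap S=\varnothing,\ T\cup S\in\mathcal K\}$ and $\chi(\mathcal L)=\sum_{\varnothing\ne T\in\mathcal L}(-1)^{|T|-1}$ (so $\chi(\{\varnothing\})=0$). $\mu$-vector: $\mu_k(\mathcal K)=(-1)^{m-k-1}\sum_{j=0}^k\binom{m-j}{k-j}\alpha_j(\mathcal K)$, $0\le k\le m-1$. Functions: $E_{\mathcal K}(t)=\sum_{i=0}^{m-1}f_{i-1}(e^t-1)^i$ and $M_{\mathcal K}(t)=e^{mt}-\sum_{i=0}^{m-1}f_{i-1}(e^t-1)^{m-i}$.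 *)

theory Defs imports Complex_Main begin

definition simplicial_complex :: "nat \<Rightarrow> nat set set \<Rightarrow> bool" where
  "simplicial_complex m K \<longleftrightarrow>
     K \<subseteq> Pow {1..m} \<and> {} \<in> K \<and> (\<forall>S\<in>K. \<forall>T. T \<subseteq> S \<longrightarrow> T \<in> K)"

(* The index is an integer because f_(-1) counts the empty face. *)
definition f_num :: "nat set set \<Rightarrow> int \<Rightarrow> nat" where
  "f_num K i = card {S \<in> K. int (card S) = i + 1}"

definition alexander_dual :: "nat \<Rightarrow> nat set set \<Rightarrow> nat set set" where
  "alexander_dual m K = {{1..m} - \<tau> | \<tau>. \<tau> \<subseteq> {1..m} \<and> \<tau> \<notin> K}"

definition link :: "nat set set \<Rightarrow> nat set \<Rightarrow> nat set set" where
  "link K S = {T \<in> K. T \<inter> S = {} \<and> T \<union> S \<in> K}"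

definition euler_char :: "nat set set \<Rightarrow> int" where
  "euler_char L = (\<Sum>T \<in> L - {{}}. (-1) ^ (card T - 1))"

definition alpha :: "nat set set \<Rightarrow> nat \<Rightarrow> int" where
  "alpha K k = (\<Sum>S \<in> {S \<in> K. card S = k}. 1 - euler_char (link K S))"

(* Only meaningful for k < m: otherwise the subtraction in the exponent truncates. *)
definition mu :: "nat \<Rightarrow> nat set set \<Rightarrow> nat \<Rightarrow> int" where
  "mu m K k = (-1) ^ (m - k - 1) * (\<Sum>j = 0..k. int ((m - j) choose (k - j)) * alpha K j)"

(* The type class of t covers both real and complex arguments. *)
definition E_fun :: "nat \<Rightarrow> nat set set \<Rightarrow> 'a::{real_normed_field,banach} \<Rightarrow> 'a" where
  "E_fun m K t = (\<Sum>i = 0..m - 1. of_nat (f_num K (int i - 1)) * (exp t - 1) ^ i)"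

definition M_fun :: "nat \<Rightarrow> nat set set \<Rightarrow> 'a::{real_normed_field,banach} \<Rightarrow> 'a" where
  "M_fun m K t =
     exp (of_nat m * t) - (\<Sum>i = 0..m - 1. of_nat (f_num K (int i - 1)) * (exp t - 1) ^ (m - i))"

end

theory Submission imports Defs begin

text \<open>
  Grouping the flags \<open>S \<subseteq> U \<in> K\<close> by \<open>U\<close> instead of \<open>S\<close> turns the \<open>\<alpha>\<close>-vector into
  \<open>\<alpha>\<^sub>k(K) = (\<Sum>U\<in>K. (-1)\<^bsup>|U|+k\<^esup> (|U| choose k))\<close>, so all four quantities become sums over faces of a
  weight depending only on the cardinality. Since the faces of the dual are the complements of the
  non-faces of \<open>K\<close>, a sum of weights \<open>g |S|\<close> over the dual is the sum over all subsets of the vertex set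
  minus the sum of \<open>g (m - |S|)\<close> over \<open>K\<close>. For \<open>g i = (exp t - 1)^i\<close> the full sum is \<open>exp (m t)\<close>; for the
  weights of \<open>\<alpha>\<^sub>k\<close> with \<open>k < m\<close> it vanishes.
\<close>

lemma finite_complex: "K \<subseteq> Pow {1..m} \<Longrightarrow> finite (K :: nat set set)"
  by (rule finite_subset[of _ "Pow {1..m}"]) auto

text \<open>Used twice: \<open>x = exp t - 1\<close> yields the term
  \<open>exp (of_nat m * t)\<close> of \<open>M_fun\<close>, and \<open>x = -1\<close> yields 0 for
  a nonempty vertex set.\<close>

lemma sum_Pow_power_card:
  fixes x :: "'a::comm_ring_1"
  assumes "finite A"
  shows "(\<Sum>S\<in>Pow A. x ^ card S) = (1 + x) ^ card A"
  using assms
proof (induction A)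
  case empty
  then show ?case by simp
next
  case (insert a A)
  have fin: "finite S" "a \<notin> S" if "S \<in> Pow A" for S
    using that insert.hyps finite_subset by auto
  have inj: "inj_on (insert a) (Pow A)"
    using insert.hyps(2) by (auto simp: inj_on_def)
  have "(\<Sum>S\<in>Pow (insert a A). x ^ card S)
      = (\<Sum>S\<in>Pow A. x ^ card S) + (\<Sum>S\<in>insert a ` Pow A. x ^ card S)"
    unfolding Pow_insert using insert.hyps by (intro sum.union_disjoint) auto
  also have "(\<Sum>S\<in>insert a ` Pow A. x ^ card S) = (\<Sum>S\<in>Pow A. x * x ^ card S)"
    unfolding sum.reindex[OF inj] o_def using fin by (intro sum.cong) auto
  also have "(\<Sum>S\<in>Pow A. x ^ card S) + \<dots> = (1 + x) * (\<Sum>S\<in>Pow A. x ^ card S)"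
    by (simp add: sum_distrib_left sum.distrib algebra_simps)
  finally show ?case
    using insert by simp
qed

text \<open>Inclusion-exclusion for the \<open>k\<close>-subsets of an \<open>(n + u)\<close>-set
  that avoid a fixed \<open>u\<close>-set: the second binomial counts those containing
  \<open>j\<close> prescribed elements. It evaluates the inner sum of \<open>mu\<close> at a single
  face. The formal proof is by induction through Pascal's rule.\<close>

lemma sum_alternating_choose_mult_choose:
  "(\<Sum>j\<le>k. (-1) ^ j * int (u choose j) * int ((n + u - j) choose (k - j))) = int (n choose k)"
proof (induction u arbitrary: n k)
  case 0
  have "(\<Sum>j\<le>k. (-1) ^ j * int (0 choose j) * int ((n + 0 - j) choose (k - j)))
      = (\<Sum>j\<in>{0}. (-1) ^ j * int (0 choose j) * int ((n + 0 - j) choose (k - j)))"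
    by (rule sum.mono_neutral_right) auto
  then show ?case by simp
next
  case (Suc u)
  show ?case
  proof (cases k)
    case 0
    then show ?thesis by simp
  next
    case (Suc k')
    let ?f = "\<lambda>j. (-1) ^ j * int (u choose j) * int ((Suc n + u - j) choose (Suc k' - j))"
    let ?g = "\<lambda>j. (-1) ^ j * int (u choose j) * int ((n + u - j) choose (k' - j))"
    \<comment> \<open>Pascal's rule for \<open>Suc u choose Suc j\<close>. The two pieces are
      summands of the induction hypothesis, at \<open>Suc n\<close> with \<open>Suc k'\<close> and
      at \<open>n\<close> with \<open>k'\<close>; Pascal's rule in \<open>n\<close> then recombines
      the results.\<close>
    have "(-1) ^ Suc j * int (Suc u choose Suc j) * int ((n + Suc u - Suc j) choose (Suc k' - Suc j))
        = ?f (Suc j) - ?g j" for j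
      by (simp add: algebra_simps)
    then have "(\<Sum>j\<le>k. (-1) ^ j * int (Suc u choose j) * int ((n + Suc u - j) choose (k - j)))
        = ?f 0 + (\<Sum>j\<le>k'. ?f (Suc j) - ?g j)"
      unfolding Suc sum.atMost_Suc_shift by (simp only:) simp
    also have "\<dots> = (\<Sum>j\<le>Suc k'. ?f j) - (\<Sum>j\<le>k'. ?g j)"
      unfolding sum.atMost_Suc_shift by (simp add: sum_subtractf)
    also have "\<dots> = int (Suc n choose Suc k') - int (n choose k')"
      by (simp only: Suc.IH)
    finally show ?thesis using Suc by simp
  qed
qed

text \<open>The 1 is the contribution of the empty face, which \<open>euler_char\<close> omits, so
  the result is minus the reduced Euler characteristic.\<close>

lemma one_minus_euler_char:
  assumes "finite L" "{} \<in> L" "\<And>T. T \<in> L \<Longrightarrow> finite T"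
  shows "1 - euler_char L = (\<Sum>T\<in>L. (-1) ^ card T)"
proof -
  have "euler_char L = - (\<Sum>T\<in>L - {{}}. (-1) ^ card T)"
    unfolding euler_char_def sum_negf[symmetric]
  proof (rule sum.cong)
    fix T assume "T \<in> L - {{}}"
    then have "card T > 0" using assms(3) by (auto simp: card_gt_0_iff)
    then show "(-1) ^ (card T - 1) = - ((-1) ^ card T :: int)"
      by (cases "card T") auto
  qed simp
  moreover have "(\<Sum>T\<in>L. (-1) ^ card T) = 1 + (\<Sum>T\<in>L - {{}}. (-1) ^ card T :: int)"
    using sum.remove[OF assms(1,2), of "\<lambda>T. (-1) ^ card T"] by simp
  ultimately show ?thesis by simp
qed

lemma one_minus_euler_char_link:
  assumes "simplicial_complex m K" "S \<in> K"
  shows "1 - euler_char (link K S) = (\<Sum>T\<in>link K S. (-1) ^ card T)"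
proof (rule one_minus_euler_char)
  have K: "K \<subseteq> Pow {1..m}" "{} \<in> K"
    using assms(1) by (auto simp: simplicial_complex_def)
  show "finite (link K S)"
    using finite_complex[OF K(1)] by (simp add: link_def)
  show "{} \<in> link K S"
    using K assms(2) by (simp add: link_def)
  show "finite T" if "T \<in> link K S" for T
    using that K(1) finite_subset[of T "{1..m}"] by (auto simp: link_def)
qed

lemma alpha_eq_sum_choose:
  assumes "simplicial_complex m K"
  shows "alpha K k = (\<Sum>U\<in>K. (-1) ^ (card U + k) * int (card U choose k))"
proof -
  have K: "K \<subseteq> Pow {1..m}" and sub: "\<And>S T. S \<in> K \<Longrightarrow> T \<subseteq> S \<Longrightarrow> T \<in> K"
    using assms by (auto simp: simplicial_complex_def)
  have finK: "finite K" by (rule finite_complex[OF K])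
  have finU: "finite U" if "U \<in> K" for U
    using that K finite_subset[of U "{1..m}"] by auto
  have "1 - euler_char (link K S) = (\<Sum>U | U \<in> K \<and> S \<subseteq> U. (-1) ^ (card U + k))"
    if S: "S \<in> {S \<in> K. card S = k}" for S
  proof -
    have "1 - euler_char (link K S) = (\<Sum>T\<in>link K S. (-1) ^ card T)"
      using one_minus_euler_char_link[OF assms] S by simp
    also have "\<dots> = (\<Sum>U | U \<in> K \<and> S \<subseteq> U. (-1) ^ (card U + k))"
    \<comment> \<open>Faces of the link of \<open>S\<close> correspond to faces of \<open>K\<close>
      containing \<open>S\<close>. The added \<open>k\<close> in the exponent cancels the sign
      caused by the \<open>k\<close> elements of \<open>S\<close>.\<close>
    proof (rule sum.reindex_bij_witness[where i = "\<lambda>U. U - S" and j = "\<lambda>T. T \<union> S"])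
      fix T assume T: "T \<in> link K S"
      then have "card (T \<union> S) = card T + k"
        using S finU by (subst card_Un_disjoint) (auto simp: link_def)
      then show "(-1) ^ (card (T \<union> S) + k) = ((-1) ^ card T :: int)"
        by (simp add: power_add flip: power_mult_distrib)
    qed (use sub in \<open>auto simp: link_def Un_absorb2\<close>)
    finally show ?thesis .
  qed
  then have "alpha K k = (\<Sum>S | S \<in> K \<and> card S = k. \<Sum>U | U \<in> K \<and> S \<subseteq> U. (-1) ^ (card U + k))"
    unfolding alpha_def by (intro sum.cong) auto
  also have "\<dots> = (\<Sum>U\<in>K. \<Sum>S | S \<in> {S \<in> K. card S = k} \<and> S \<subseteq> U. (-1) ^ (card U + k))"
    using finK by (intro sum.swap_restrict) auto
  also have "\<dots> = (\<Sum>U\<in>K. (-1) ^ (card U + k) * int (card U choose k))"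
  proof (rule sum.cong)
    fix U assume U: "U \<in> K"
    \<comment> \<open>Since \<open>K\<close> is closed under subsets, no \<open>k\<close>-subset of
      \<open>U\<close> is lost by requiring it to be a face.\<close>
    then have "{S. S \<in> {S \<in> K. card S = k} \<and> S \<subseteq> U} = {S. S \<subseteq> U \<and> card S = k}"
      using sub by auto
    then show "(\<Sum>S | S \<in> {S \<in> K. card S = k} \<and> S \<subseteq> U. (-1) ^ (card U + k))
        = (-1) ^ (card U + k) * int (card U choose k)"
      using n_subsets[OF finU[OF U]] by simp
  qed simp
  finally show ?thesis .
qed

text \<open>The link of a \<open>k\<close>-face in the full simplex is a full simplex on
  \<open>m - k > 0\<close> vertices, whose alternating sum is
  \<open>(1 - 1) ^ (m - k) = 0\<close>.\<close>

lemma alpha_Pow: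
  assumes "k < m"
  shows "alpha (Pow {1..m}) k = 0"
  unfolding alpha_def
proof (rule sum.neutral, rule ballI)
  fix S assume "S \<in> {S \<in> Pow {1..m}. card S = k}"
  then have S: "S \<subseteq> {1..m}" "card S = k" by auto
  have "link (Pow {1..m}) S = Pow ({1..m} - S)"
    using S(1) by (auto simp: link_def)
  moreover have "simplicial_complex m (Pow {1..m})"
    by (auto simp: simplicial_complex_def)
  ultimately have "1 - euler_char (link (Pow {1..m}) S) = (\<Sum>T\<in>Pow ({1..m} - S). (-1) ^ card T)"
    using S(1) by (metis PowI one_minus_euler_char_link)
  moreover have "card ({1..m} - S) = m - k"
    using S finite_subset[OF S(1)] by (simp add: card_Diff_subset)
  ultimately show "1 - euler_char (link (Pow {1..m}) S) = 0"
    using assms by (simp add: sum_Pow_power_card)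
qed

lemma simplicial_complex_alexander_dual:
  assumes "simplicial_complex m K" "K \<noteq> Pow {1..m}"
  shows "simplicial_complex m (alexander_dual m K)"
  unfolding simplicial_complex_def
proof (intro conjI ballI allI impI)
  have sub: "\<And>S T. S \<in> K \<Longrightarrow> T \<subseteq> S \<Longrightarrow> T \<in> K" and K: "K \<subseteq> Pow {1..m}"
    using assms(1) by (auto simp: simplicial_complex_def)
  show "alexander_dual m K \<subseteq> Pow {1..m}"
    by (auto simp: alexander_dual_def)
  \<comment> \<open>A complex containing the whole vertex set is the full simplex. So the vertex set
    is a non-face, and its complement puts the empty face into the dual.\<close>
  have "{1..m} \<notin> K" using sub K assms(2) by blast
  then show "{} \<in> alexander_dual m K"
    unfolding alexander_dual_def by (force intro: exI[of _ "{1..m}"])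
  fix S T assume "S \<in> alexander_dual m K" and T: "T \<subseteq> S"
  then obtain \<tau> where \<tau>: "S = {1..m} - \<tau>" "\<tau> \<subseteq> {1..m}" "\<tau> \<notin> K"
    by (auto simp: alexander_dual_def)
  then have "\<tau> \<subseteq> {1..m} - T" "T = {1..m} - ({1..m} - T)" using T by auto
  then show "T \<in> alexander_dual m K"
    unfolding alexander_dual_def using sub \<tau>(3) by blast
qed

lemma sum_alexander_dual:
  fixes g :: "nat \<Rightarrow> 'a::ab_group_add"
  assumes "K \<subseteq> Pow {1..m}"
  shows "(\<Sum>S\<in>alexander_dual m K. g (card S))
       = (\<Sum>S\<in>Pow {1..m}. g (card S)) - (\<Sum>S\<in>K. g (m - card S))"
proof -
  have card: "card ({1..m} - S) = m - card S" if "S \<subseteq> {1..m}" for S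
    using that finite_subset[OF that] by (simp add: card_Diff_subset)
  \<comment> \<open>Stated for arbitrary \<open>L\<close> because \<open>L = {}\<close> is used too:
    its dual is the whole power set, which gives the symmetry of that sum under
    complementation.\<close>
  have dual: "(\<Sum>S\<in>alexander_dual m L. g (card S)) = (\<Sum>S\<in>Pow {1..m} - L. g (m - card S))" for L
  proof -
    have "alexander_dual m L = (-) {1..m} ` (Pow {1..m} - L)"
      unfolding alexander_dual_def by blast
    moreover have "inj_on ((-) {1..m}) (Pow {1..m} - L)"
      by (rule inj_onI) blast
    ultimately show ?thesis
      by (simp add: sum.reindex card del: One_nat_def)
  qed
  have "alexander_dual m {} = Pow {1..m}"
    unfolding alexander_dual_def by blast
  with dual[of "{}"] have "(\<Sum>S\<in>Pow {1..m}. g (m - card S)) = (\<Sum>S\<in>Pow {1..m}. g (card S))"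
    by simp
  then show ?thesis
    using dual[of K] assms by (simp add: sum_diff)
qed

text \<open>Excluding the full face matches the upper limit \<open>m - 1\<close>; the shift in
  \<open>int i - 1\<close> makes \<open>i\<close> the number of elements of a face.\<close>

lemma sum_f_num:
  fixes g :: "nat \<Rightarrow> 'a::comm_semiring_1"
  assumes "K \<subseteq> Pow {1..m}" "{1..m} \<notin> K"
  shows "(\<Sum>i = 0..m - 1. of_nat (f_num K (int i - 1)) * g i) = (\<Sum>S\<in>K. g (card S))"
proof -
  have "card S < m" if "S \<in> K" for S
    using that assms psubset_card_mono[of "{1..m}" S] by auto
  then have "(\<Sum>S\<in>K. g (card S)) = (\<Sum>i = 0..m - 1. \<Sum>S | S \<in> K \<and> card S = i. g (card S))"
    using finite_complex[OF assms(1)] by (intro sum.group[symmetric]) force+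
  then show ?thesis
    by (simp add: f_num_def)
qed

theorem proposition3p8:
  fixes m :: nat and K :: "nat set set"
  assumes "m \<ge> 2"
    and "simplicial_complex m K"
    and "K \<noteq> Pow {1..m}"
  shows "(\<forall>t :: 'a::{real_normed_field,banach}. M_fun m K t = E_fun m (alexander_dual m K) t)
       \<and> (\<forall>i \<in> {0..m - 1}. mu m K i = alpha (alexander_dual m K) i)"
proof (intro conjI allI ballI)
  let ?D = "alexander_dual m K"
  have K: "K \<subseteq> Pow {1..m}" and empty: "{} \<in> K" and sub: "\<And>S T. S \<in> K \<Longrightarrow> T \<subseteq> S \<Longrightarrow> T \<in> K"
    using assms(2) by (auto simp: simplicial_complex_def)
  have D: "simplicial_complex m ?D"
    using assms by (intro simplicial_complex_alexander_dual)
  {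
    fix t :: 'a
    let ?x = "exp t - 1"
    have "{1..m} \<notin> K" using sub K assms(3) by blast
    then have M: "M_fun m K t = exp (of_nat m * t) - (\<Sum>S\<in>K. ?x ^ (m - card S))"
      unfolding M_fun_def by (subst sum_f_num[OF K, of "\<lambda>i. ?x ^ (m - i)"]) auto
    \<comment> \<open>Only the empty set has the full vertex set as complement, and it is a face of
      \<open>K\<close>. Hence \<open>sum_f_num\<close> applies to the dual.\<close>
    have "{1..m} \<notin> ?D"
    proof
      assume "{1..m} \<in> ?D"
      then obtain \<tau> where "{1..m} = {1..m} - \<tau>" "\<tau> \<subseteq> {1..m}" "\<tau> \<notin> K"
        unfolding alexander_dual_def by auto
      moreover from this have "\<tau> = {}" by blast
      ultimately show False using empty by simp
    qed
    moreover have "?D \<subseteq> Pow {1..m}"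
      using D by (simp add: simplicial_complex_def)
    ultimately have "E_fun m ?D t = (\<Sum>S\<in>?D. ?x ^ card S)"
      unfolding E_fun_def by (intro sum_f_num)
    also have "\<dots> = (\<Sum>S\<in>Pow {1..m}. ?x ^ card S) - (\<Sum>S\<in>K. ?x ^ (m - card S))"
      using sum_alexander_dual[OF K, of "\<lambda>i. ?x ^ i"] .
    also have "(\<Sum>S\<in>Pow {1..m}. ?x ^ card S) = exp (of_nat m * t)"
      by (simp add: sum_Pow_power_card exp_of_nat_mult)
    finally show "M_fun m K t = E_fun m ?D t"
      using M by simp
  }
  fix k assume "k \<in> {0..m - 1}"
  then have k: "k < m" using assms(1) by auto
  \<comment> \<open>The weight of a face of size \<open>i\<close> in
    \<open>alpha_eq_sum_choose\<close>.\<close>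
  let ?w = "\<lambda>i. (-1) ^ (i + k) * int (i choose k)"
  have le: "card U \<le> m" if "U \<in> K" for U
    using that K card_mono[of "{1..m}" U] by auto
  have "(\<Sum>j = 0..k. int ((m - j) choose (k - j)) * alpha K j)
      = (\<Sum>U\<in>K. \<Sum>j\<le>k. (-1) ^ card U * ((-1) ^ j * int (card U choose j) * int ((m - j) choose (k - j))))"
    unfolding alpha_eq_sum_choose[OF assms(2)] sum_distrib_left atLeast0AtMost
    by (subst sum.swap) (simp add: power_add mult_ac)
  also have "\<dots> = (\<Sum>U\<in>K. (-1) ^ card U * int ((m - card U) choose k))"
  proof (rule sum.cong)
    fix U assume "U \<in> K"
    then have "(\<Sum>j\<le>k. (-1) ^ j * int (card U choose j) * int ((m - j) choose (k - j)))
        = int ((m - card U) choose k)"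
      \<comment> \<open>Here \<open>n + u = m\<close>, because \<open>card U\<close> is at most
        \<open>m\<close>.\<close>
      using sum_alternating_choose_mult_choose[of "card U" "m - card U" k] le[of U] by simp
    then show "(\<Sum>j\<le>k. (-1) ^ card U * ((-1) ^ j * int (card U choose j) * int ((m - j) choose (k - j))))
        = (-1) ^ card U * int ((m - card U) choose k)"
      by (simp only: sum_distrib_left[symmetric])
  qed simp
  finally have "mu m K k = (\<Sum>U\<in>K. (-1) ^ (m - k - 1) * ((-1) ^ card U * int ((m - card U) choose k)))"
    unfolding mu_def by (simp add: sum_distrib_left)
  also have "\<dots> = - (\<Sum>U\<in>K. ?w (m - card U))"
    unfolding sum_negf[symmetric]
  proof (rule sum.cong)
    fix U assume "U \<in> K"
    \<comment> \<open>The two exponents add up to \<open>2 * m - 1\<close>, which is odd;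
      \<open>k < m\<close> and \<open>card U \<le> m\<close> keep the subtractions from
      truncating.\<close>
    then have "even (m - k - 1 + card U) \<longleftrightarrow> odd (m - card U + k)"
      using k le[of U] by presburger
    then have "(-1) ^ (m - k - 1 + card U) = - ((-1) ^ (m - card U + k) :: int)"
      by (simp add: minus_one_power_iff)
    then show "(-1) ^ (m - k - 1) * ((-1) ^ card U * int ((m - card U) choose k)) = - ?w (m - card U)"
      by (simp only: power_add[symmetric] mult.assoc[symmetric] minus_mult_left)
  qed simp
  \<comment> \<open>Inserting this zero supplies the sum over all subsets required by
    \<open>sum_alexander_dual\<close>.\<close>
  also have "\<dots> = alpha (Pow {1..m}) k - (\<Sum>U\<in>K. ?w (m - card U))"
    using alpha_Pow[OF k] by simp
  also have "\<dots> = (\<Sum>S\<in>Pow {1..m}. ?w (card S)) - (\<Sum>U\<in>K. ?w (m - card U))"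
    by (subst alpha_eq_sum_choose[of m]) (auto simp: simplicial_complex_def)
  also have "\<dots> = alpha ?D k"
    using sum_alexander_dual[OF K, of ?w] alpha_eq_sum_choose[OF D] by simp
  finally show "mu m K k = alpha ?D k" .
qed

end
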